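(* If $S$ is a $\sigma$-compact and sequentially compact cancellative topological monoid with open shifts, then $S$ has countable cellularity.
   Context: A topological monoid is a monoid $S$ with a topology for which the operation $S\times S\to S$ is continuous. It has open shifts if for every $a\in S$ and every open $U\subseteq S$ the sets $aU$ and $Ua$ are open in $S$. Cancellative means that each of $ax=ay$ and $xa=ya$ implies $x=y$. No separation axiom is assumed. A space is $\sigma$-compact if it is a countable union of compact subsets (compact: every open cover has a finite subcover), and sequentially compact if every sequence in it has a subsequence converging in it. A cellular family in a space $X$ is a nonempty family of pairwise disjoint nonempty open subsets of $X$; the cellularity is $c(X)=\sup\{|\mathcal{U}|:\mathcal{U}\text{ a cellular family in }X\}+\aleph_0$, and $X$ has countable cellularity (the Souslin property) if $c(X)=\aleph_0$. *)

theory Defs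
  imports "HOL-Analysis.Analysis"
begin

unbundle cardinal_syntax
no_notation (input) Set_Algebras.elt_set_eq (infix "=o" 50)

definition open_shifts :: "'a::{topological_space, monoid_mult} itself \<Rightarrow> bool" where
  "open_shifts _ \<longleftrightarrow>
     (\<forall>(a::'a) U. open U \<longrightarrow> open ((\<lambda>x. a * x) ` U) \<and> open ((\<lambda>x. x * a) ` U))"

definition cancellative :: "'a::monoid_mult itself \<Rightarrow> bool" where
  "cancellative _ \<longleftrightarrow>
     (\<forall>(a::'a) x y. (a * x = a * y \<longrightarrow> x = y) \<and> (x * a = y * a \<longrightarrow> x = y))"

definition sigma_compact :: "'a::topological_space set \<Rightarrow> bool" where
  "sigma_compact S \<longleftrightarrow> (\<exists>\<K>. countable \<K> \<and> (\<forall>K\<in>\<K>. compact K) \<and> S = \<Union>\<K>)"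

definition cellular_family :: "'a topology \<Rightarrow> 'a set set \<Rightarrow> bool" where
  "cellular_family X \<U> \<longleftrightarrow>
     \<U> \<noteq> {} \<and> (\<forall>U\<in>\<U>. openin X U \<and> U \<noteq> {}) \<and> disjoint \<U>"

text \<open>
  The supremum of the cardinals of the cellular families. Cardinals are the minimal well-orders of
  the library's cardinal theory, so the supremum is a least upper bound with respect to \<open>\<le>o\<close>,
  unique up to \<open>=o\<close>. Every cellular family is a set of subsets of the carrier, so all
  the cardinals involved, and the supremum, have representatives on the type \<^typ>\<open>'a set\<close>.
\<close>

definition is_cellular_sup :: "'a topology \<Rightarrow> 'a set rel \<Rightarrow> bool" where
  "is_cellular_sup X r \<longleftrightarrow>
     Card_order r \<and> (\<forall>\<U>. cellular_family X \<U> \<longrightarrow> |\<U>| \<le>o r) \<and>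
     (\<forall>s :: 'a set rel. Card_order s \<and> (\<forall>\<U>. cellular_family X \<U> \<longrightarrow> |\<U>| \<le>o s) \<longrightarrow> r \<le>o s)"

lemma is_cellular_sup_exists: "\<exists>r. is_cellular_sup X r"
proof -
  define R :: "'a set rel set"
    where "R = {r. Card_order r \<and> (\<forall>\<U>. cellular_family X \<U> \<longrightarrow> |\<U>| \<le>o r)}"
  have "|UNIV :: 'a set set| \<in> R"
    unfolding R_def by (simp add: card_of_Card_order card_of_mono1)
  then have "R \<noteq> {}" by blast
  moreover have "\<forall>r\<in>R. Card_order r" unfolding R_def by blast
  ultimately obtain r where "r \<in> R" "\<forall>s\<in>R. r \<le>o s"
    using exists_minim_Card_order by blast
  then show ?thesis unfolding is_cellular_sup_def R_def by blast
qed

lemma is_cellular_sup_unique: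
  assumes "is_cellular_sup X r" "is_cellular_sup X s"
  shows "r =o s"
  using assms unfolding is_cellular_sup_def ordIso_iff_ordLeq by blast

definition cellularity :: "'a topology \<Rightarrow> ('a set + nat) rel" where
  "cellularity X = (SOME r. is_cellular_sup X r) +c natLeq"

definition countable_cellularity :: "'a topology \<Rightarrow> bool" where
  "countable_cellularity X \<longleftrightarrow> cellularity X =o natLeq"

end

theory Submission
  imports Defs "HOL-Library.Countable_Set_Type"
begin

text \<open>
  Sequential compactness makes inversion continuous at the identity up to closures
  (\<open>weak_inverse_continuity\<close>), although inverses need not exist. Hence the monoid is precompact in a
  weak sense, on either side, and every neighbourhood \<open>V\<close> of the identity gives a finite colouring
  such that \<open>q\<close> is in the closure of \<open>gV\<close> (or of \<open>Vg\<close>) whenever \<open>g\<close> and \<open>q\<close> have the same colour.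

  Given uncountably many disjoint open sets \<open>U\<close> with points \<open>x U\<close>, Uspenskij's argument with the Mal'cev
  operation \<open>a g\<inverse> b\<close> applies: colourings attached to the sets yield \<open>A \<noteq> B\<close> and \<open>G\<close> for which
  \<open>x A (x G)\<inverse> (x B)\<close> would lie in both \<open>A\<close> and \<open>B\<close> up to closures. Replacing closures by
  approximation gives small \<open>s, t, v, w\<close> with \<open>s (x B) = (x G) v\<close> and \<open>(x A) t = w (x G)\<close>, so that
  \<open>(x A) t v = w s (x B)\<close> is a genuine common point.
\<close>

section \<open>Finite colourings of an uncountable index set\<close>

text \<open>A closing-off argument. A finite \<open>F\<close> induces only finitely many colour
  patterns on \<open>I\<close>, so finitely many points realise all of them. Adding such points for
  every finite subset, and repeating this along the natural numbers, keeps the set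
  countable.\<close>

lemma ex_countable_dense_for_finite_colourings:
  fixes c :: "'i \<Rightarrow> 'i \<Rightarrow> 'b"
  assumes fin: "\<And>a. a \<in> I \<Longrightarrow> finite (c a ` I)"
  obtains A where "A \<subseteq> I" "countable A"
    "\<And>F b. finite F \<Longrightarrow> F \<subseteq> A \<Longrightarrow> b \<in> I \<Longrightarrow> \<exists>g\<in>A. \<forall>a\<in>F. c a g = c a b"
proof -
  define dns where "dns F G \<longleftrightarrow>
      G \<subseteq> I \<and> finite G \<and> (\<forall>b\<in>I. \<exists>g\<in>G. \<forall>a\<in>F. c a g = c a b)" for F G
  have ex_dns: "\<exists>G. dns F G" if F: "finite F" "F \<subseteq> I" for F
  proof -
    define h where "h b = restrict (\<lambda>a. c a b) F" for b
    have "h ` I \<subseteq> PiE F (\<lambda>a. c a ` I)" by (auto simp: h_def)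
    moreover have "finite (PiE F (\<lambda>a. c a ` I))"
      using F fin by (intro finite_PiE) auto
    ultimately have "finite (h ` I)" by (rule finite_subset)
    then obtain G where G: "G \<subseteq> I" "finite G" "h ` I = h ` G"
      using finite_subset_image[of "h ` I" h I] by blast
    have "\<exists>g\<in>G. \<forall>a\<in>F. c a g = c a b" if "b \<in> I" for b
    proof -
      have "h b \<in> h ` G" using that unfolding G(3)[symmetric] by (rule imageI)
      then obtain g where g: "h b = h g" "g \<in> G" by (rule imageE)
      have "c a g = c a b" if "a \<in> F" for a
        using that fun_cong[OF g(1), of a] by (simp add: h_def)
      with g(2) show ?thesis by blast
    qed
    with G(1,2) show ?thesis unfolding dns_def by blast
  qed
  define G where "G F = (SOME G. dns F G)" for F
  have "dns F (G F)" if "finite F" "F \<subseteq> I" for F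
    unfolding G_def using ex_dns[OF that] by (rule someI_ex)
  then have G: "G F \<subseteq> I" "finite (G F)" "\<forall>b\<in>I. \<exists>g\<in>G F. \<forall>a\<in>F. c a g = c a b"
    if "finite F" "F \<subseteq> I" for F
    using that unfolding dns_def by blast+
  define A where
    "A = rec_nat {} (\<lambda>_ B. B \<union> (\<Union>F\<in>{F. finite F \<and> F \<subseteq> B}. G F))"
  have A0: "A 0 = {}"
    and AS: "A (Suc n) = A n \<union> (\<Union>F\<in>{F. finite F \<and> F \<subseteq> A n}. G F)" for n
    by (simp_all add: A_def)
  have A: "A n \<subseteq> I \<and> countable (A n)" for n
  proof (induction n)
    case 0
    show ?case by (simp add: A0)
  next
    case (Suc n)
    have GF: "G F \<subseteq> I" "countable (G F)" if "finite F \<and> F \<subseteq> A n" for F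
      using that Suc G(1,2)[of F] order_trans[of F "A n" I] by (simp_all add: countable_finite)
    have "countable (\<Union>F\<in>{F. finite F \<and> F \<subseteq> A n}. G F)"
      using Suc GF(2) by (intro countable_UN countable_Collect_finite_subset) simp_all
    moreover have "(\<Union>F\<in>{F. finite F \<and> F \<subseteq> A n}. G F) \<subseteq> I"
      using GF(1) by (intro UN_least) simp
    ultimately show ?case
      unfolding AS using Suc by simp
  qed
  have mono: "incseq A"
    by (rule incseq_SucI) (auto simp: AS)
  show thesis
  proof (rule that[of "\<Union>n. A n"])
    show "(\<Union>n. A n) \<subseteq> I" "countable (\<Union>n. A n)" using A by auto
    fix F b assume F: "finite F" "F \<subseteq> (\<Union>n. A n)" and b: "b \<in> I"
    have "\<exists>n. F \<subseteq> A n"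
      using F
    proof (induction F rule: finite_induct)
      case (insert x F)
      then obtain n m where "F \<subseteq> A n" "x \<in> A m" by auto
      then have "insert x F \<subseteq> A (max n m)"
        using incseqD[OF mono, of n "max n m"] incseqD[OF mono, of m "max n m"] by auto
      then show ?case by blast
    qed simp
    then obtain n where n: "F \<subseteq> A n" by blast
    then have "F \<subseteq> I" using A by blast
    then obtain g where "g \<in> G F" "\<forall>a\<in>F. c a g = c a b" using G(3)[OF F(1)] b by blast
    moreover have "G F \<subseteq> A (Suc n)" unfolding AS using n F(1) by blast
    ultimately show "\<exists>g\<in>\<Union>n. A n. \<forall>a\<in>F. c a g = c a b" by blast
  qed
qed

text \<open>Take \<open>b\<close> outside the countable set \<open>A\<close> of the preceding lemma.
  On \<open>A\<close> the colouring \<open>c b\<close> has finitely many values, all attained on a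
  finite \<open>F\<close> inside \<open>A\<close>. Some \<open>g\<close> in \<open>A\<close> looks
  like \<open>b\<close> to every colouring from \<open>F\<close>, and the \<open>a\<close> in
  \<open>F\<close> with the \<open>c b\<close>-colour of \<open>g\<close> completes the
  triple.\<close>

lemma finite_colourings_uncountable:
  fixes c :: "'i \<Rightarrow> 'i \<Rightarrow> 'b"
  assumes fin: "\<And>a. a \<in> I \<Longrightarrow> finite (c a ` I)" and unc: "uncountable I"
  obtains a b g where "a \<in> I" "b \<in> I" "g \<in> I" "a \<noteq> b" "c a g = c a b" "c b g = c b a"
proof -
  obtain A where A: "A \<subseteq> I" "countable A"
    and dense: "\<And>F b. finite F \<Longrightarrow> F \<subseteq> A \<Longrightarrow> b \<in> I \<Longrightarrow> \<exists>g\<in>A. \<forall>a\<in>F. c a g = c a b"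
    by (rule ex_countable_dense_for_finite_colourings[of I c, OF fin]) auto
  obtain b where b: "b \<in> I" "b \<notin> A"
    using A(1,2) unc by (metis subset_antisym subsetI)
  have "finite (c b ` A)" using fin[OF b(1)] A(1) by (meson finite_subset image_mono)
  then obtain F where F: "F \<subseteq> A" "finite F" "c b ` A = c b ` F"
    using finite_subset_image[of "c b ` A" "c b" A] by blast
  obtain g where g: "g \<in> A" "\<forall>a\<in>F. c a g = c a b" using dense[OF F(2,1) b(1)] by blast
  have "c b g \<in> c b ` F" using g(1) unfolding F(3)[symmetric] by (rule imageI)
  then obtain a where a: "c b g = c b a" "a \<in> F" by (rule imageE)
  show thesis
  proof (rule that)
    show "a \<in> I" "b \<in> I" "g \<in> I" "a \<noteq> b" using a(2) g(1) b F(1) A(1) by blast+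
    show "c a g = c a b" using g(2) a(2) by blast
    show "c b g = c b a" by (rule a(1))
  qed
qed

section \<open>Translations and weak continuity of inversion\<close>

text \<open>The operation is a parameter rather than a class constant, so that the results can be
  interpreted a second time for the reversed multiplication.\<close>

locale seq_compact_cancellative_monoid = monoid f z
  for f :: "'a::topological_space \<Rightarrow> 'a \<Rightarrow> 'a"  (infixl \<open>\<^bold>*\<close> 70) and z :: 'a  (\<open>\<^bold>1\<close>) +
  assumes continuous_mult: "continuous_on UNIV (\<lambda>p. fst p \<^bold>* snd p)"
    and left_cancel: "a \<^bold>* x = a \<^bold>* y \<Longrightarrow> x = y"
    and right_cancel: "x \<^bold>* a = y \<^bold>* a \<Longrightarrow> x = y"
    and open_left_shift: "open U \<Longrightarrow> open ((\<^bold>*) a ` U)"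
    and open_right_shift: "open U \<Longrightarrow> open ((\<lambda>x. x \<^bold>* a) ` U)"
    and seq_compact: "seq_compact (UNIV :: 'a set)"
begin

lemma continuous_left: "continuous_on UNIV (\<lambda>x. a \<^bold>* x)"
  using continuous_on_compose2[OF continuous_mult, of UNIV "\<lambda>x. (a, x)"]
  by (simp add: continuous_on_Pair continuous_on_const continuous_on_id)

lemma continuous_right: "continuous_on UNIV (\<lambda>x. x \<^bold>* a)"
  using continuous_on_compose2[OF continuous_mult, of UNIV "\<lambda>x. (x, a)"]
  by (simp add: continuous_on_Pair continuous_on_const continuous_on_id)

lemma left_mem_closure: "x \<in> closure A \<Longrightarrow> a \<^bold>* x \<in> closure ((\<^bold>*) a ` A)"
  by (rule continuous_image_closure_subset[OF continuous_left, THEN subsetD]) auto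

lemma right_mem_closure: "x \<in> closure A \<Longrightarrow> x \<^bold>* a \<in> closure ((\<lambda>x. x \<^bold>* a) ` A)"
  by (rule continuous_image_closure_subset[OF continuous_right, THEN subsetD]) auto

lemma unit_nbhd_left:
  assumes "open U" "a \<in> U"
  obtains Q where "open Q" "\<^bold>1 \<in> Q" "\<And>x. x \<in> Q \<Longrightarrow> a \<^bold>* x \<in> U"
  using assms open_vimage[OF assms(1) continuous_left[of a]]
  by (intro that[of "(\<^bold>*) a -` U"]) simp_all

lemma unit_nbhd_right:
  assumes "open U" "a \<in> U"
  obtains Q where "open Q" "\<^bold>1 \<in> Q" "\<And>x. x \<in> Q \<Longrightarrow> x \<^bold>* a \<in> U"
  using assms open_vimage[OF assms(1) continuous_right[of a]]
  by (intro that[of "(\<lambda>x. x \<^bold>* a) -` U"]) simp_all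

lemma unit_nbhd_square:
  assumes "open V" "\<^bold>1 \<in> V"
  obtains W where "open W" "\<^bold>1 \<in> W" "\<And>x y. x \<in> W \<Longrightarrow> y \<in> W \<Longrightarrow> x \<^bold>* y \<in> V"
proof -
  have "open ((\<lambda>p. fst p \<^bold>* snd p) -` V)"
    by (rule open_vimage[OF \<open>open V\<close> continuous_mult])
  then obtain A B where AB: "open A" "open B" "(\<^bold>1, \<^bold>1) \<in> A \<times> B"
      "A \<times> B \<subseteq> (\<lambda>p. fst p \<^bold>* snd p) -` V"
    using \<open>\<^bold>1 \<in> V\<close> by (auto elim!: open_prod_elim)
  then show thesis
    by (intro that[of "A \<inter> B"]) (auto simp: subset_iff)
qed

text \<open>Shifts by \<open>b\<close> of neighbourhoods of the identity are neighbourhoods of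
  \<open>b\<close>, so \<open>y k\<close> is eventually divisible by \<open>b\<close>. Cancellation
  makes the quotient unique, hence it lies in each such neighbourhood eventually.\<close>

lemma tendsto_left_factor:
  fixes y :: "nat \<Rightarrow> 'a"
  assumes "y \<longlonglongrightarrow> b"
  obtains u where "u \<longlonglongrightarrow> \<^bold>1" "\<forall>\<^sub>F k in sequentially. y k = b \<^bold>* u k"
proof -
  \<comment> \<open>The value is arbitrary where \<open>y k\<close> is not a multiple of
    \<open>b\<close>, hence the factorisation holds only eventually.\<close>
  define u where "u k = (SOME u. y k = b \<^bold>* u)" for k
  have ev: "\<forall>\<^sub>F k in sequentially. y k = b \<^bold>* u k \<and> u k \<in> Q" if "open Q" "\<^bold>1 \<in> Q" for Q
  proof -
    have "b \<in> (\<^bold>*) b ` Q" using that by force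
    then have "\<forall>\<^sub>F k in sequentially. y k \<in> (\<^bold>*) b ` Q"
      using topological_tendstoD[OF assms open_left_shift[OF that(1)]] by blast
    then show ?thesis
    proof (rule eventually_mono)
      fix k assume "y k \<in> (\<^bold>*) b ` Q"
      then obtain v where v: "v \<in> Q" "y k = b \<^bold>* v" by blast
      then have "y k = b \<^bold>* u k" unfolding u_def by (intro someI) 
      with v show "y k = b \<^bold>* u k \<and> u k \<in> Q" using left_cancel by metis
    qed
  qed
  show thesis
  proof (rule that)
    show "u \<longlonglongrightarrow> \<^bold>1"
      by (rule topological_tendstoI) (use ev eventually_mono in fastforce)
    show "\<forall>\<^sub>F k in sequentially. y k = b \<^bold>* u k"
      using ev[of UNIV] by simp
  qed
qed

text \<open>For a group the conclusion says that \<open>x\<inverse>\<close> lies in the closure of \<open>V\<close> for \<open>x\<close> near the identity. If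
  it failed, take bad \<open>x n\<close> tending rapidly to \<open>\<^bold>1\<close>: a subsequence of the products \<open>x 0 \<^bold>* \<dots> \<^bold>* x (n - 1)\<close> has
  the form \<open>b \<^bold>* u k\<close> with \<open>u k\<close> tending to \<open>\<^bold>1\<close>, and cancelling \<open>b\<close> leaves \<open>u l = u k \<^bold>* x (r k) \<^bold>* B\<close> with
  \<open>B\<close> small.\<close>

lemma weak_inverse_continuity:
  assumes V: "open V" "\<^bold>1 \<in> V"
  shows "\<exists>N. open N \<and> \<^bold>1 \<in> N \<and> (\<forall>x\<in>N. \<^bold>1 \<in> closure ((\<^bold>*) x ` V))"
proof (rule ccontr)
  assume "\<not> ?thesis"
  then have bad: "\<exists>x\<in>N. \<^bold>1 \<notin> closure ((\<^bold>*) x ` V)" if "open N" "\<^bold>1 \<in> N" for N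
    using that by blast
  define nb where "nb W \<longleftrightarrow> open W \<and> \<^bold>1 \<in> W" for W
  define sq where "sq A B \<longleftrightarrow> (\<forall>x\<in>B. \<forall>y\<in>B. x \<^bold>* y \<in> A)" for A B
  have half: "\<exists>B. nb B \<and> sq A B" if "nb A" for A
    using that unit_nbhd_square[of A] unfolding nb_def sq_def by metis
  obtain W0 where W0: "nb W0" "sq V W0" using half[of V] V by (auto simp: nb_def)
  \<comment> \<open>Starting at \<open>W0\<close> ensures that a product of two elements of
    \<open>W 0\<close> lies in \<open>V\<close>; the two factors will be \<open>B\<close> and
    \<open>u k\<close>.\<close>
  have "\<exists>W. \<forall>n. (nb (W n) \<and> (n = 0 \<longrightarrow> W n = W0)) \<and> sq (W n) (W (Suc n))"
    by (rule dependent_nat_choice) (use W0 half in auto)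
  then obtain W where nbW: "\<And>n. nb (W n)" and "W 0 = W0"
    and sqW: "\<And>n. sq (W n) (W (Suc n))" by blast
  with W0 have VW: "x \<^bold>* y \<in> V" if "x \<in> W 0" "y \<in> W 0" for x y
    using that by (auto simp: sq_def)
  have WW: "x \<^bold>* y \<in> W n" if "x \<in> W (Suc n)" "y \<in> W (Suc n)" for x y n
    using that sqW by (auto simp: sq_def)
  have "W (Suc n) \<subseteq> W n" for n
    using WW[of _ n "\<^bold>1"] nbW by (auto simp: nb_def)
  then have W_0: "W n \<subseteq> W 0" for n
    by (induction n) auto
  \<comment> \<open>The shift to \<open>Suc n\<close> leaves room for a tail: \<open>x n\<close>
    times an element of \<open>W (Suc n)\<close> is in \<open>W n\<close>. So products starting at
    index \<open>m\<close> stay in \<open>W m\<close>, whatever their length.\<close>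
  have "\<forall>n. \<exists>x. x \<in> W (Suc n) \<and> \<^bold>1 \<notin> closure ((\<^bold>*) x ` V)"
    using bad nbW unfolding nb_def by blast
  then obtain x where xW: "\<And>n. x n \<in> W (Suc n)"
    and xV: "\<And>n. \<^bold>1 \<notin> closure ((\<^bold>*) (x n) ` V)" by metis
  define P where "P m j = foldr (\<^bold>*) (map x [m..<m+j]) \<^bold>1" for m j
  have P0: "P m 0 = \<^bold>1" for m by (simp add: P_def)
  have PS: "P m (Suc j) = x m \<^bold>* P (Suc m) j" for m j
    by (simp add: P_def upt_conv_Cons del: upt_Suc)
  have PW: "P m j \<in> W m" for m j
  proof (induction j arbitrary: m)
    case 0
    show ?case using nbW by (simp add: P0 nb_def)
  next
    case (Suc j)
    show ?case unfolding PS using WW xW Suc by blast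
  qed
  have Padd: "P m (i + j) = P m i \<^bold>* P (m + i) j" for m i j
    by (induction i arbitrary: m) (simp_all add: P0 PS assoc)
  obtain b r where r: "strict_mono r" "(P 0 \<circ> r) \<longlonglongrightarrow> b"
    using seq_compact unfolding seq_compact_def by blast
  obtain u where u: "u \<longlonglongrightarrow> \<^bold>1" "\<forall>\<^sub>F k in sequentially. P 0 (r k) = b \<^bold>* u k"
    using tendsto_left_factor[OF r(2)] by auto
  have "\<forall>\<^sub>F k in sequentially. u k \<in> W 0"
    using u(1) nbW[of 0] by (auto simp: nb_def dest: topological_tendstoD)
  with u(2) have "\<forall>\<^sub>F k in sequentially. u k \<in> W 0 \<and> P 0 (r k) = b \<^bold>* u k"
    by eventually_elim simp
  then obtain k where k: "u k \<in> W 0" "P 0 (r k) = b \<^bold>* u k"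
    by (auto simp: eventually_sequentially)
  have "\<^bold>1 \<in> closure ((\<^bold>*) (x (r k)) ` V)"
    unfolding closure_iff_nhds_not_empty
  proof (intro allI impI)
    fix A Q assume "Q \<subseteq> A" "open Q" "\<^bold>1 \<in> Q"
    \<comment> \<open>This replaces conjugation by \<open>u k\<close>: openness of the left shift
      yields \<open>Q'\<close> such that multiplying \<open>Q'\<close> by \<open>u k\<close> on the
      right lands in the left translate of \<open>Q\<close> by \<open>u k\<close>. Cancelling
      \<open>u k\<close> later gives the required point \<open>h\<close> of
      \<open>Q\<close>.\<close>
    have "u k \<in> (\<^bold>*) (u k) ` Q"
      by (rule image_eqI[of _ _ "\<^bold>1"]) (simp_all add: \<open>\<^bold>1 \<in> Q\<close>)
    with open_left_shift[OF \<open>open Q\<close>, of "u k"]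
    obtain Q' where Q': "open Q'" "\<^bold>1 \<in> Q'" "\<And>t. t \<in> Q' \<Longrightarrow> t \<^bold>* u k \<in> (\<^bold>*) (u k) ` Q"
      using unit_nbhd_right by metis
    have "\<forall>\<^sub>F l in sequentially. u l \<in> Q'"
      using topological_tendstoD[OF u(1)] Q' by blast
    with u(2) eventually_gt_at_top[of k]
    have "\<forall>\<^sub>F l in sequentially. P 0 (r l) = b \<^bold>* u l \<and> u l \<in> Q' \<and> k < l"
      by eventually_elim simp
    then obtain l where l: "P 0 (r l) = b \<^bold>* u l" "u l \<in> Q'" "k < l"
      by (auto simp: eventually_sequentially)
    have "r k < r l" using r(1) l(3) by (simp add: strict_monoD)
    then obtain j where j: "r l = r k + Suc j" by (metis add_Suc_right less_imp_Suc_add)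
    define B where "B = P (Suc (r k)) j"
    have "B \<in> W 0" using PW W_0 unfolding B_def by blast
    have "P 0 (r l) = P 0 (r k) \<^bold>* P (r k) (Suc j)"
      using Padd[of 0 "r k" "Suc j"] by (simp only: j add_0)
    then have "b \<^bold>* u l = b \<^bold>* (u k \<^bold>* (x (r k) \<^bold>* B))"
      by (simp only: l(1) k(2) PS B_def assoc)
    then have ul: "u l = u k \<^bold>* (x (r k) \<^bold>* B)" by (rule left_cancel)
    obtain h where h: "h \<in> Q" "u l \<^bold>* u k = u k \<^bold>* h" using Q'(3)[OF l(2)] by blast
    then have "u k \<^bold>* h = u k \<^bold>* (x (r k) \<^bold>* (B \<^bold>* u k))" by (simp add: ul assoc)
    then have "h = x (r k) \<^bold>* (B \<^bold>* u k)" by (rule left_cancel)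
    then show "(\<^bold>*) (x (r k)) ` V \<inter> A \<noteq> {}"
      using VW[OF \<open>B \<in> W 0\<close> k(1)] h(1) \<open>Q \<subseteq> A\<close> by blast
  qed
  with xV show False by blast
qed

section \<open>Precompactness and colourings of the monoid\<close>

text \<open>Otherwise some sequence avoids the closures of the translates by its earlier terms.
  Along a convergent subsequence the terms are \<open>b\<close> times \<open>v k\<close> with
  \<open>v k\<close> small. Weak inverse continuity puts the identity in the closure of the
  translate of \<open>W\<close> by \<open>v k\<close>; multiplying by \<open>v l\<close> on the
  right gives a contradiction.\<close>

lemma weakly_precompact:
  assumes N: "open N" "\<^bold>1 \<in> N"
  shows "\<exists>F. finite F \<and> (\<forall>s. \<exists>a\<in>F. s \<in> closure ((\<^bold>*) a ` N))"
proof (rule ccontr)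
  assume "\<not> ?thesis"
  then have neg: "\<exists>s. \<forall>a\<in>F. s \<notin> closure ((\<^bold>*) a ` N)" if "finite F" for F
    using that by blast
  have "\<exists>x. \<forall>n::nat. (\<forall>i\<in>{..<n}. x n \<notin> closure ((\<^bold>*) (x i) ` N))"
  proof -
    have "\<exists>x. \<forall>n::nat. (\<lambda>x n s. \<forall>i\<in>{..<n}. s \<notin> closure ((\<^bold>*) (x i) ` N)) x n (x n)"
    proof (rule dependent_wellorder_choice)
      fix n :: nat and x :: "nat \<Rightarrow> 'a"
      show "\<exists>s. \<forall>i\<in>{..<n}. s \<notin> closure ((\<^bold>*) (x i) ` N)"
        using neg[of "x ` {..<n}"] by auto
    qed auto
    then show ?thesis by simp
  qed
  then obtain x where x: "\<And>n i :: nat. i < n \<Longrightarrow> x n \<notin> closure ((\<^bold>*) (x i) ` N)" by auto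
  obtain b r where r: "strict_mono r" "(x \<circ> r) \<longlonglongrightarrow> b"
    using seq_compact unfolding seq_compact_def by blast
  obtain v where v: "v \<longlonglongrightarrow> \<^bold>1" "\<forall>\<^sub>F k in sequentially. x (r k) = b \<^bold>* v k"
    using tendsto_left_factor[OF r(2)] by auto
  obtain W where W: "open W" "\<^bold>1 \<in> W" "\<And>s t. s \<in> W \<Longrightarrow> t \<in> W \<Longrightarrow> s \<^bold>* t \<in> N"
    using unit_nbhd_square[OF N] by metis
  obtain M where M: "open M" "\<^bold>1 \<in> M" "\<And>s. s \<in> M \<Longrightarrow> \<^bold>1 \<in> closure ((\<^bold>*) s ` W)"
    using weak_inverse_continuity[OF W(1,2)] by metis
  have "\<forall>\<^sub>F k in sequentially. v k \<in> M" "\<forall>\<^sub>F k in sequentially. v k \<in> W"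
    using topological_tendstoD[OF v(1)] W M by blast+
  with v(2) have "\<forall>\<^sub>F k in sequentially. x (r k) = b \<^bold>* v k \<and> v k \<in> M \<and> v k \<in> W"
    by eventually_elim simp
  then obtain k where k: "\<And>l. k \<le> l \<Longrightarrow> x (r l) = b \<^bold>* v l \<and> v l \<in> M \<and> v l \<in> W"
    by (auto simp: eventually_sequentially)
  define l where "l = Suc k"
  have "\<^bold>1 \<^bold>* v l \<in> closure ((\<lambda>s. s \<^bold>* v l) ` (\<^bold>*) (v k) ` W)"
    using M(3) k by (intro right_mem_closure) auto
  moreover have "(\<lambda>s. s \<^bold>* v l) ` (\<^bold>*) (v k) ` W \<subseteq> (\<^bold>*) (v k) ` N"
    using W(3) k[of l] by (auto simp: l_def assoc)
  ultimately have "v l \<in> closure ((\<^bold>*) (v k) ` N)"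
    using closure_mono left_neutral by (metis subsetD)
  then have "b \<^bold>* v l \<in> closure ((\<^bold>*) b ` (\<^bold>*) (v k) ` N)" by (rule left_mem_closure)
  also have "(\<^bold>*) b ` (\<^bold>*) (v k) ` N = (\<^bold>*) (x (r k)) ` N"
    using k[of k] by (simp add: image_image assoc)
  finally have "x (r l) \<in> closure ((\<^bold>*) (x (r k)) ` N)" using k[of l] by (simp add: l_def)
  moreover have "r k < r l" using r(1) by (simp add: l_def strict_monoD)
  ultimately show False using x by blast
qed

text \<open>The colour is a centre of a finite net. If \<open>g\<close> and \<open>q\<close> share
  the centre \<open>a\<close>, small right factors of \<open>g\<close> and \<open>a\<close> give a
  common point; weak inverse continuity leads from there back to \<open>a\<close>, up to closure,
  and one more small factor leads from \<open>a\<close> to \<open>q\<close>.\<close>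

lemma ex_finite_colouring:
  assumes V: "open V" "\<^bold>1 \<in> V"
  obtains c :: "'a \<Rightarrow> 'a" where "finite (range c)"
    "\<And>g q. c g = c q \<Longrightarrow> q \<in> closure ((\<^bold>*) g ` V)"
proof -
  obtain U where U: "open U" "\<^bold>1 \<in> U" "\<And>s t. s \<in> U \<Longrightarrow> t \<in> U \<Longrightarrow> s \<^bold>* t \<in> V"
    using unit_nbhd_square[OF V] by metis
  obtain W where W: "open W" "\<^bold>1 \<in> W" "\<And>s t. s \<in> W \<Longrightarrow> t \<in> W \<Longrightarrow> s \<^bold>* t \<in> U"
    using unit_nbhd_square[OF U(1,2)] by metis
  obtain M where M: "open M" "\<^bold>1 \<in> M" "\<And>s. s \<in> M \<Longrightarrow> \<^bold>1 \<in> closure ((\<^bold>*) s ` W)"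
    using weak_inverse_continuity[OF W(1,2)] by metis
  define N where "N = M \<inter> U"
  have N: "open N" "\<^bold>1 \<in> N" using M U by (auto simp: N_def)
  obtain F where F: "finite F" "\<And>s. \<exists>a\<in>F. s \<in> closure ((\<^bold>*) a ` N)"
    using weakly_precompact[OF N] by metis
  then obtain c where c: "\<And>s. c s \<in> F" "\<And>s. s \<in> closure ((\<^bold>*) (c s) ` N)" by metis
  show thesis
  proof (rule that)
    show "finite (range c)" using c(1) F(1) by (meson finite_subset image_subsetI)
    fix g q assume eq: "c g = c q"
    define a where "a = c g"
    have "g \<in> (\<^bold>*) g ` W" using W(2) by force
    moreover have "g \<in> closure ((\<^bold>*) a ` N)" using c(2) by (simp add: a_def)
    ultimately have "(\<^bold>*) g ` W \<inter> (\<^bold>*) a ` N \<noteq> {}"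
      using open_left_shift[OF W(1)] open_Int_closure_eq_empty by blast
    then obtain s n where sn: "s \<in> W" "n \<in> N" "g \<^bold>* s = a \<^bold>* n" by auto
    have "a \<^bold>* \<^bold>1 \<in> closure ((\<^bold>*) a ` (\<^bold>*) n ` W)"
      using M(3) sn(2) by (intro left_mem_closure) (simp add: N_def)
    also have "(\<^bold>*) a ` (\<^bold>*) n ` W = (\<^bold>*) g ` (\<^bold>*) s ` W"
      by (simp add: image_image sn(3) flip: assoc)
    finally have a: "a \<in> closure ((\<^bold>*) g ` (\<^bold>*) s ` W)" by simp
    have "(\<^bold>*) a ` N \<subseteq> closure ((\<^bold>*) g ` V)"
    proof
      fix y assume "y \<in> (\<^bold>*) a ` N"
      then obtain t where t: "t \<in> N" "y = a \<^bold>* t" by blast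
      have "(\<lambda>x. x \<^bold>* t) ` (\<^bold>*) g ` (\<^bold>*) s ` W \<subseteq> (\<^bold>*) g ` V"
        using W(3)[OF sn(1)] U(3) t(1) by (auto simp: N_def assoc[of g])
      then show "y \<in> closure ((\<^bold>*) g ` V)"
        using right_mem_closure[OF a, of t] closure_mono unfolding t(2) by blast
    qed
    then have "closure ((\<^bold>*) a ` N) \<subseteq> closure ((\<^bold>*) g ` V)" by (simp add: closure_minimal)
    then show "q \<in> closure ((\<^bold>*) g ` V)" using c(2)[of q] eq by (auto simp: a_def)
  qed
qed

text \<open>Transfers the colourings from left translates to right translates.\<close>

lemma opposite: "seq_compact_cancellative_monoid (\<lambda>x y. y \<^bold>* x) \<^bold>1"
proof
  show "continuous_on UNIV (\<lambda>p. snd p \<^bold>* fst p)"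
    using continuous_on_compose2[OF continuous_mult continuous_on_swap, of UNIV]
    by (simp add: case_prod_beta)
qed (simp_all add: assoc open_left_shift open_right_shift seq_compact,
    (erule right_cancel left_cancel)+)

section \<open>Countability of disjoint families of open sets\<close>

lemma disjoint_open_countable:
  fixes \<U> :: "'a set set"
  assumes \<U>: "\<And>U. U \<in> \<U> \<Longrightarrow> open U" "\<And>U. U \<in> \<U> \<Longrightarrow> U \<noteq> {}" and "disjoint \<U>"
  shows "countable \<U>"
proof (rule ccontr)
  assume unc: "uncountable \<U>"
  interpret op: seq_compact_cancellative_monoid "\<lambda>x y. y \<^bold>* x" "\<^bold>1" by (rule opposite)
  obtain x where x: "\<And>U. U \<in> \<U> \<Longrightarrow> x U \<in> U" using \<U>(2) by (metis ex_in_conv)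
  \<comment> \<open>Two small factors are allowed for because the common point is reached by two
    successive approximations, each contributing one factor at \<open>A\<close> and one at
    \<open>B\<close>.\<close>
  have "\<exists>V. open V \<and> \<^bold>1 \<in> V \<and>
      (\<forall>s\<in>V. \<forall>t\<in>V. x U \<^bold>* (s \<^bold>* t) \<in> U \<and> (s \<^bold>* t) \<^bold>* x U \<in> U)"
    if U: "U \<in> \<U>" for U
  proof -
    obtain A where A: "open A" "\<^bold>1 \<in> A" "\<And>s. s \<in> A \<Longrightarrow> x U \<^bold>* s \<in> U"
      using unit_nbhd_left[OF \<U>(1)[OF U] x[OF U]] by metis
    obtain B where B: "open B" "\<^bold>1 \<in> B" "\<And>s. s \<in> B \<Longrightarrow> s \<^bold>* x U \<in> U"
      using unit_nbhd_right[OF \<U>(1)[OF U] x[OF U]] by metis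
    obtain V where "open V" "\<^bold>1 \<in> V" "\<And>s t. s \<in> V \<Longrightarrow> t \<in> V \<Longrightarrow> s \<^bold>* t \<in> A \<inter> B"
      using unit_nbhd_square[of "A \<inter> B"] A B by (metis IntI open_Int)
    then show ?thesis using A(3) B(3) by blast
  qed
  then have "\<forall>U\<in>\<U>. \<exists>V. open V \<and> \<^bold>1 \<in> V \<and>
      (\<forall>s\<in>V. \<forall>t\<in>V. x U \<^bold>* (s \<^bold>* t) \<in> U \<and> (s \<^bold>* t) \<^bold>* x U \<in> U)"
    by blast
  from bchoice[OF this] obtain V where "\<forall>U\<in>\<U>. open (V U) \<and> \<^bold>1 \<in> V U \<and>
      (\<forall>s\<in>V U. \<forall>t\<in>V U. x U \<^bold>* (s \<^bold>* t) \<in> U \<and> (s \<^bold>* t) \<^bold>* x U \<in> U)"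
    by (rule exE)
  then have V: "\<And>U. U \<in> \<U> \<Longrightarrow> open (V U)" "\<And>U. U \<in> \<U> \<Longrightarrow> \<^bold>1 \<in> V U"
    and VL: "\<And>U s t. U \<in> \<U> \<Longrightarrow> s \<in> V U \<Longrightarrow> t \<in> V U \<Longrightarrow> x U \<^bold>* (s \<^bold>* t) \<in> U"
    and VR: "\<And>U s t. U \<in> \<U> \<Longrightarrow> s \<in> V U \<Longrightarrow> t \<in> V U \<Longrightarrow> (s \<^bold>* t) \<^bold>* x U \<in> U"
    by blast+
  have "\<exists>c :: 'a \<Rightarrow> 'a. finite (range c) \<and>
      (\<forall>g q. c g = c q \<longrightarrow> q \<in> closure ((\<^bold>*) g ` V U))" if "U \<in> \<U>" for U
    using ex_finite_colouring[of "V U"] V[OF that] by metis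
  then obtain c :: "'a set \<Rightarrow> 'a \<Rightarrow> 'a" where c: "\<And>U. U \<in> \<U> \<Longrightarrow> finite (range (c U))"
    "\<And>U g q. U \<in> \<U> \<Longrightarrow> c U g = c U q \<Longrightarrow> q \<in> closure ((\<^bold>*) g ` V U)"
    by metis
  have "\<exists>d :: 'a \<Rightarrow> 'a. finite (range d) \<and>
      (\<forall>g q. d g = d q \<longrightarrow> q \<in> closure ((\<lambda>s. s \<^bold>* g) ` V U))" if "U \<in> \<U>" for U
    using op.ex_finite_colouring[of "V U"] V[OF that] by metis
  then obtain d :: "'a set \<Rightarrow> 'a \<Rightarrow> 'a" where d: "\<And>U. U \<in> \<U> \<Longrightarrow> finite (range (d U))"
    "\<And>U g q. U \<in> \<U> \<Longrightarrow> d U g = d U q \<Longrightarrow> q \<in> closure ((\<lambda>s. s \<^bold>* g) ` V U)"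
    by metis
  \<comment> \<open>Pairing the colours lets a single application of the combinatorial lemma control
    left translates at \<open>A\<close> and right translates at \<open>B\<close>.\<close>
  have "finite ((\<lambda>T. (c U (x T), d U (x T))) ` \<U>)" if "U \<in> \<U>" for U
    by (rule finite_subset[of _ "range (c U) \<times> range (d U)"]) (use c(1) d(1) that in auto)
  then obtain A B G where AB: "A \<in> \<U>" "B \<in> \<U>" "A \<noteq> B"
    and col: "c A (x G) = c A (x B)" "d B (x G) = d B (x A)"
    by (rule finite_colourings_uncountable[where c = "\<lambda>U T. (c U (x T), d U (x T))", OF _ unc])
      auto
  have "x B \<in> (\<lambda>s. s \<^bold>* x B) ` V B" using V(2)[OF AB(2)] by force
  then have "(\<lambda>s. s \<^bold>* x B) ` V B \<inter> (\<^bold>*) (x G) ` V A \<noteq> {}"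
    using c(2)[OF AB(1) col(1)] open_right_shift[OF V(1)[OF AB(2)]] open_Int_closure_eq_empty
    by blast
  then obtain s v where s: "s \<in> V B" "v \<in> V A" "s \<^bold>* x B = x G \<^bold>* v" by auto
  have "x A \<in> (\<^bold>*) (x A) ` V A" using V(2)[OF AB(1)] by force
  then have "(\<^bold>*) (x A) ` V A \<inter> (\<lambda>s. s \<^bold>* x G) ` V B \<noteq> {}"
    using d(2)[OF AB(2) col(2)] open_left_shift[OF V(1)[OF AB(1)]] open_Int_closure_eq_empty
    by blast
  then obtain t w where t: "t \<in> V A" "w \<in> V B" "x A \<^bold>* t = w \<^bold>* x G" by auto
  have "x A \<^bold>* (t \<^bold>* v) = (w \<^bold>* s) \<^bold>* x B"
    using s(3) t(3) by (metis assoc)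
  moreover have "x A \<^bold>* (t \<^bold>* v) \<in> A" using VL AB s t by blast
  moreover have "(w \<^bold>* s) \<^bold>* x B \<in> B" using VR AB s t by blast
  ultimately show False using AB \<open>disjoint \<U>\<close> by (auto simp: disjoint_def)
qed

end

section \<open>From countable families to the cardinal invariant\<close>

text \<open>Leastness in \<open>is_cellular_sup\<close> concerns only cardinals on
  \<open>'a set\<close>, so \<open>natLeq\<close> cannot serve directly as the competing bound. A
  countable \<open>\<B>\<close> of that type, dominating all countable families, takes its
  place.\<close>

lemma countable_cellularityI:
  fixes X :: "'a topology"
  assumes "\<And>\<U>. cellular_family X \<U> \<Longrightarrow> countable \<U>"
  shows "countable_cellularity X"
proof -
  define r where "r = (SOME r. is_cellular_sup X r)"
  have r: "is_cellular_sup X r"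
    unfolding r_def using is_cellular_sup_exists by (rule someI_ex)
  obtain \<B> :: "'a set set" where \<B>: "countable \<B>" "\<And>\<U> :: 'a set set. countable \<U> \<Longrightarrow> |\<U>| \<le>o |\<B>|"
  proof (cases "finite (UNIV :: 'a set set)")
    case True
    show thesis
    proof (rule that)
      show "countable (UNIV :: 'a set set)" using True by (rule countable_finite)
      show "|\<U>| \<le>o |UNIV :: 'a set set|" for \<U> :: "'a set set" by (simp add: card_of_mono1)
    qed
  next
    case False
    then obtain \<B> :: "'a set set" where \<B>: "countable \<B>" "infinite \<B>"
      using infinite_countable_subset' by blast
    show thesis
    proof (rule that)
      show "countable \<B>" by (rule \<B>)
      have "natLeq \<le>o |\<B>|" using \<B>(2) infinite_iff_natLeq_ordLeq by blast
      then show "|\<U>| \<le>o |\<B>|" if "countable \<U>" for \<U> :: "'a set set"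
        using that ordLeq_transitive unfolding countable_card_le_natLeq by blast
    qed
  qed
  have "r \<le>o |\<B>|"
    using r assms \<B>(2) card_of_Card_order unfolding is_cellular_sup_def by blast
  then have "r \<le>o natLeq"
    using \<B>(1) ordLeq_transitive countable_card_le_natLeq by blast
  then show ?thesis
    unfolding countable_cellularity_def cellularity_def r_def[symmetric]
    by (rule csum_absorb2[OF natLeq_Cinfinite])
qed

theorem theorem4p8:
  assumes "sigma_compact (UNIV :: 'a::{topological_semigroup_mult, monoid_mult} set)"
    and "seq_compact (UNIV :: 'a set)"
    and "cancellative TYPE('a)"
    and "open_shifts TYPE('a)"
  shows "countable_cellularity (euclidean :: 'a topology)"
proof -
  interpret seq_compact_cancellative_monoid "(*) :: 'a \<Rightarrow> 'a \<Rightarrow> 'a" 1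
  proof
    fix a x y :: 'a and U :: "'a set"
    show "a * x = a * y \<Longrightarrow> x = y" "x * a = y * a \<Longrightarrow> x = y"
      using assms(3) unfolding cancellative_def by blast+
    show "open U \<Longrightarrow> open ((*) a ` U)" "open U \<Longrightarrow> open ((\<lambda>x. x * a) ` U)"
      using assms(4) unfolding open_shifts_def by blast+
    show "continuous_on UNIV (\<lambda>p :: 'a \<times> 'a. fst p * snd p)"
      unfolding continuous_on_def
      by (intro ballI tendsto_mult tendsto_fst tendsto_snd tendsto_ident_at)
  qed (rule assms(2))
  show ?thesis
    by (rule countable_cellularityI) (auto simp: cellular_family_def intro!: disjoint_open_countable)
qed

end
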